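(* Let $\alpha\in\{1/2,1/4,1/8,1/16,1/32\}$ and let $r,\theta\ge0$ be fixed such that $(\alpha,r,\theta)$-expanders exist. Then the strong Kalton constant satisfies $K_s\le \frac{2r+N_2-\theta}{1-\theta}$, where $N_2=-\tfrac12$ if $\alpha=\tfrac12$; $N_2=\tfrac12$ if $\alpha=\tfrac14$; $N_2=2$ if $\alpha=\tfrac18$; $N_2=3$ if $\alpha=\tfrac1{16}$; and $N_2=4.5$ if $\alpha=\tfrac1{32}$.
   Context: For $k\in\mathbb{N}$ and reals $\alpha,r,\theta\ge0$ with $\alpha,\theta<1$ and $r>2$, a bipartite graph $G_k(V,W;E)$ is an $(\alpha,r,\theta)$-expander if $|V|=2k$, $|W|=2\theta k$, $|E|=2kr$, and every set $S\subset V$ of at most $2k\alpha$ vertices has at least $|S|$ neighbors in $W$. We say $(\alpha,r,\theta)$-expanders exist if there is $k'\in\mathbb{N}$ such that for every positive integer multiple $k$ of $k'$ there exists an $(\alpha,r,\theta)$-expander $G_k$. A set function over $[n]$ is $\epsilon$-modular if $|f(S)+f(T)-f(S\cup T)-f(S\cap T)|\le\epsilon$ for all $S,T\subseteq[n]$; linear if $f(S)=c_0+\sum_{i\in S}c_i$ for constants $c_i$; $\Delta$-linear if some linear $\ell$ has $|f(S)-\ell(S)|\le\Delta$ for all $S$. The strong Kalton constant $K_s$ is the smallest constant such that every $\epsilon$-modular set function (over any $[n]$, any $\epsilon\ge0$) is $K_s\epsilon$-linear. *)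

theory Defs
  imports "HOL-Analysis.Analysis"
begin

text \<open>
  The two sides of the bipartite graph are the sets \<open>V\<close> and \<open>W\<close>, possibly of different types and
  understood as disjoint; an edge is an element of \<open>V \<times> W\<close>, so there are no parallel edges. The
  neighbourhood of \<open>S \<subseteq> V\<close> is the image \<open>E `` S\<close>. Finiteness of \<open>W\<close> is required because \<open>card\<close>
  of an infinite set is \<open>0\<close>.
\<close>

definition is_expander ::
  "real \<Rightarrow> real \<Rightarrow> real \<Rightarrow> nat \<Rightarrow> 'v set \<Rightarrow> 'w set \<Rightarrow> ('v \<times> 'w) set \<Rightarrow> bool" where
  "is_expander \<alpha> r \<theta> k V W E \<longleftrightarrow>
     0 \<le> \<alpha> \<and> \<alpha> < 1 \<and> 0 \<le> r \<and> 2 < r \<and> 0 \<le> \<theta> \<and> \<theta> < 1 \<and>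
     finite V \<and> finite W \<and> E \<subseteq> V \<times> W \<and>
     real (card V) = 2 * real k \<and>
     real (card W) = 2 * \<theta> * real k \<and>
     real (card E) = 2 * real k * r \<and>
     (\<forall>S\<subseteq>V. real (card S) \<le> 2 * real k * \<alpha> \<longrightarrow> card S \<le> card (E `` S))"

text \<open>
  All graphs are finite, so vertices may be taken to be natural numbers. The number \<open>k'\<close> must be
  positive: \<open>k' = 0\<close> would make the condition trivially true.
\<close>

definition expanders_exist :: "real \<Rightarrow> real \<Rightarrow> real \<Rightarrow> bool" where
  "expanders_exist \<alpha> r \<theta> \<longleftrightarrow>
     (\<exists>k'>0. \<forall>k>0. k' dvd k \<longrightarrow>
        (\<exists>(V :: nat set) (W :: nat set) E. is_expander \<alpha> r \<theta> k V W E))"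

text \<open>
  A set function over \<open>{1..n}\<close> is a function \<open>nat set \<Rightarrow> real\<close> of which only the values on subsets
  of \<open>{1..n}\<close> matter.
\<close>

definition approx_modular :: "nat \<Rightarrow> real \<Rightarrow> (nat set \<Rightarrow> real) \<Rightarrow> bool" where
  "approx_modular n \<epsilon> f \<longleftrightarrow>
     (\<forall>S\<subseteq>{1..n}. \<forall>T\<subseteq>{1..n}. \<bar>f S + f T - f (S \<union> T) - f (S \<inter> T)\<bar> \<le> \<epsilon>)"

definition linear_set_function :: "nat \<Rightarrow> (nat set \<Rightarrow> real) \<Rightarrow> bool" where
  "linear_set_function n f \<longleftrightarrow> (\<exists>c\<^sub>0 c. \<forall>S\<subseteq>{1..n}. f S = c\<^sub>0 + (\<Sum>i\<in>S. c i))"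

definition approx_linear :: "nat \<Rightarrow> real \<Rightarrow> (nat set \<Rightarrow> real) \<Rightarrow> bool" where
  "approx_linear n \<Delta> f \<longleftrightarrow> (\<exists>l. linear_set_function n l \<and> (\<forall>S\<subseteq>{1..n}. \<bar>f S - l S\<bar> \<le> \<Delta>))"

definition kalton_bound :: "real \<Rightarrow> bool" where
  "kalton_bound K \<longleftrightarrow>
     (\<forall>n \<epsilon> f. \<epsilon> \<ge> 0 \<longrightarrow> approx_modular n \<epsilon> f \<longrightarrow> approx_linear n (K * \<epsilon>) f)"

text \<open>
  The infimum is taken in \<^typ>\<open>ereal\<close>, so that an upper bound includes the assertion that some finite
  constant works. Lemma \<open>strong_kalton_constant_le_iff\<close> below shows that the infimum is a minimum.
\<close>

definition strong_kalton_constant :: ereal where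
  "strong_kalton_constant = Inf (ereal ` {K. kalton_bound K})"

lemma approx_linear_closed:
  assumes ex: "\<And>\<Delta>'. \<Delta>' > \<Delta> \<Longrightarrow> approx_linear n \<Delta>' f"
  shows "approx_linear n \<Delta> f"
proof -
  have "\<exists>a c. \<forall>S\<subseteq>{1..n}. \<bar>f S - (a + (\<Sum>i\<in>S. c i))\<bar> \<le> \<Delta> + 1 / Suc m" for m
  proof -
    have "\<Delta> + 1 / Suc m > \<Delta>" by simp
    from ex[OF this] show ?thesis
      unfolding approx_linear_def linear_set_function_def by metis
  qed
  then obtain a :: "nat \<Rightarrow> real" and c :: "nat \<Rightarrow> nat \<Rightarrow> real" where
    ac: "\<And>m S. S \<subseteq> {1..n} \<Longrightarrow> \<bar>f S - (a m + (\<Sum>i\<in>S. c m i))\<bar> \<le> \<Delta> + 1 / Suc m"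
    by metis
  have le1: "\<Delta> + 1 / Suc m \<le> \<Delta> + 1" for m by simp
  have bnd_a: "\<bar>a m\<bar> \<le> \<bar>f {}\<bar> + (\<Delta> + 1)" for m
  proof -
    have "\<bar>f {} - a m\<bar> \<le> \<Delta> + 1 / Suc m" using ac[of "{}" m] by simp
    then show ?thesis using le1[of m] by linarith
  qed
  have bnd_c: "\<bar>c m i\<bar> \<le> \<bar>f {i}\<bar> + \<bar>f {}\<bar> + 2 * (\<Delta> + 1)" if "i \<in> {1..n}" for m i
  proof -
    have "\<bar>f {i} - (a m + c m i)\<bar> \<le> \<Delta> + 1 / Suc m" using ac[of "{i}" m] that by simp
    moreover have "\<bar>c m i\<bar> \<le> \<bar>f {i}\<bar> + \<bar>a m\<bar> + \<bar>f {i} - (a m + c m i)\<bar>" by arith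
    ultimately have "\<bar>c m i\<bar> \<le> \<bar>f {i}\<bar> + \<bar>a m\<bar> + (\<Delta> + 1)" using le1[of m] by linarith
    then have "\<bar>c m i\<bar> \<le> \<bar>f {i}\<bar> + (\<bar>f {}\<bar> + (\<Delta> + 1)) + (\<Delta> + 1)"
      using bnd_a[of m] by linarith
    then show ?thesis by (simp add: algebra_simps)
  qed
  define x where "x m i = (if i = 0 then a m else if i \<le> n then c m i else 0)" for m i
  define B where "B i = \<bar>f {i}\<bar> + \<bar>f {}\<bar> + 2 * (\<Delta> + 1)" for i
  have xB: "x m i \<in> {- B i .. B i}" for m i
  proof -
    have D: "0 \<le> \<Delta> + 1"
      using ac[of "{}" 0] abs_ge_zero[of "f {} - a 0"] by simp
    have "\<bar>a m\<bar> \<le> B i"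
      using bnd_a[of m] D abs_ge_zero[of "f {i}"] unfolding B_def by argo
    moreover have "0 \<le> B i" using D by (simp add: B_def)
    moreover have "\<bar>c m i\<bar> \<le> B i" if "i \<in> {1..n}"
      using bnd_c[OF that] unfolding B_def .
    ultimately have "\<bar>x m i\<bar> \<le> B i"
      by (cases "i = 0"; cases "i \<le> n") (simp_all add: x_def)
    then show ?thesis by (simp add: abs_le_iff)
  qed
  have "compact (PiE UNIV (\<lambda>i::nat. {- B i .. B i}))"
    using compactin_PiE[of "\<lambda>i::nat. euclidean" UNIV "\<lambda>i. {- B i .. B i}"]
    unfolding euclidean_product_topology compactin_euclidean_iff by simp
  moreover have "\<forall>m. x m \<in> PiE UNIV (\<lambda>i::nat. {- B i .. B i})"
    using xB by auto
  ultimately obtain y r where r: "strict_mono (r :: nat \<Rightarrow> nat)" and lim: "(x \<circ> r) \<longlonglongrightarrow> y"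
    unfolding compact_def by metis
  have limi: "(\<lambda>m. x (r m) i) \<longlonglongrightarrow> y i" for i
  proof -
    have "continuous_on UNIV (\<lambda>z :: nat \<Rightarrow> real. z i)"
      by (rule continuous_on_product_coordinates)
    from continuous_on_tendsto_compose[OF this lim] show ?thesis by (simp add: o_def)
  qed
  have "\<bar>f S - (y 0 + (\<Sum>i\<in>S. y i))\<bar> \<le> \<Delta>" if S: "S \<subseteq> {1..n}" for S
  proof (rule LIMSEQ_le)
    show "(\<lambda>m. \<bar>f S - (x (r m) 0 + (\<Sum>i\<in>S. x (r m) i))\<bar>) \<longlonglongrightarrow> \<bar>f S - (y 0 + (\<Sum>i\<in>S. y i))\<bar>"
      by (intro tendsto_intros limi)
    have "(\<lambda>m. \<Delta> + 1 / Suc m) \<longlonglongrightarrow> \<Delta> + 0"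
      by (intro tendsto_intros LIMSEQ_inverse_real_of_nat[unfolded inverse_eq_divide])
    from LIMSEQ_subseq_LIMSEQ[OF this r] show "(\<lambda>m. \<Delta> + 1 / Suc (r m)) \<longlonglongrightarrow> \<Delta>"
      by (simp add: o_def)
    have "(\<Sum>i\<in>S. x m i) = (\<Sum>i\<in>S. c m i)" for m
      using S by (intro sum.cong) (auto simp: x_def)
    then show "\<exists>N. \<forall>m\<ge>N. \<bar>f S - (x (r m) 0 + (\<Sum>i\<in>S. x (r m) i))\<bar> \<le> \<Delta> + 1 / Suc (r m)"
      using ac[OF S] by (simp add: x_def)
  qed
  then show ?thesis
    unfolding approx_linear_def linear_set_function_def
    by (intro exI[of _ "\<lambda>S. y 0 + (\<Sum>i\<in>S. y i)"]) blast
qed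

lemma kalton_bound_mono:
  assumes "kalton_bound K" "K \<le> K'"
  shows "kalton_bound K'"
proof -
  have "approx_linear n (K' * \<epsilon>) f" if e: "\<epsilon> \<ge> 0" and m: "approx_modular n \<epsilon> f" for n \<epsilon> f
  proof -
    have "approx_linear n (K * \<epsilon>) f" using assms(1) e m by (simp add: kalton_bound_def)
    moreover have "K * \<epsilon> \<le> K' * \<epsilon>" using assms(2) e by (rule mult_right_mono)
    ultimately show ?thesis unfolding approx_linear_def by (meson order_trans)
  qed
  then show ?thesis by (simp add: kalton_bound_def)
qed

lemma strong_kalton_constant_le_iff:
  "strong_kalton_constant \<le> ereal K \<longleftrightarrow> kalton_bound K"
proof
  assume "kalton_bound K"
  then show "strong_kalton_constant \<le> ereal K"
    unfolding strong_kalton_constant_def by (intro Inf_lower) simp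
next
  assume le: "strong_kalton_constant \<le> ereal K"
  have gt: "kalton_bound K'" if "K' > K" for K'
  proof -
    have "strong_kalton_constant < ereal K'" using le that by (simp add: le_less_trans)
    then obtain K'' where "kalton_bound K''" "K'' < K'"
      unfolding strong_kalton_constant_def Inf_less_iff by auto
    then show ?thesis using kalton_bound_mono by fastforce
  qed
  have "approx_linear n (K * \<epsilon>) f" if e: "\<epsilon> \<ge> 0" and m: "approx_modular n \<epsilon> f" for n \<epsilon> f
  proof (cases "\<epsilon> = 0")
    case True
    have "approx_linear n ((K + 1) * \<epsilon>) f"
      using gt[of "K + 1"] e m unfolding kalton_bound_def by simp
    with True show ?thesis by simp
  next
    case False
    show ?thesis
    proof (rule approx_linear_closed)
      fix \<Delta>' assume "\<Delta>' > K * \<epsilon>"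
      then have "\<Delta>' / \<epsilon> > K" using e False by (simp add: field_simps)
      then have "approx_linear n (\<Delta>' / \<epsilon> * \<epsilon>) f"
        using gt e m unfolding kalton_bound_def by blast
      then show "approx_linear n \<Delta>' f" using False by simp
    qed
  qed
  then show "kalton_bound K" by (simp add: kalton_bound_def)
qed

end

theory Submission
  imports Defs
begin

text \<open>
  Let \<open>l\<close> be a best linear approximation of \<open>f\<close> and \<open>M\<close> the sup norm of \<open>g = f - l\<close>. By optimality
  and a theorem of the alternative there are families \<open>P\<^sub>1, \<dots>, P\<^sub>m\<close> and \<open>N\<^sub>1, \<dots>, N\<^sub>m\<close> covering every
  item equally often, with \<open>g P\<^sub>i = M\<close> and \<open>g N\<^sub>i = - M\<close>. Combining these sets produces families \<open>S\<^sub>i\<close>,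
  \<open>S'\<^sub>i\<close> in which every item has frequency at most \<open>\<alpha>\<close> while \<open>g S\<^sub>i - g S'\<^sub>i\<close> is on average at least
  \<open>2 (M - \<delta> \<epsilon>)\<close>: the sets \<open>P\<^sub>i\<close> and the complements of \<open>N\<^sub>i\<close> give \<open>\<alpha> = 1/2\<close>, \<open>\<delta> = 1/2\<close>; the
  differences \<open>P\<^sub>i - N\<^sub>j\<close> and \<open>N\<^sub>j - P\<^sub>i\<close> give \<open>\<alpha> = 1/4\<close>, \<open>\<delta> = 1\<close>; pairwise intersections
  multiply the \<open>\<alpha>\<close>'s and add up the \<open>\<delta>\<close>'s plus one.

  Place such a family on the left side of an expander. By Hall's theorem each item can be routed from
  the sets containing it to distinct right vertices. This splits the left sets into edge pieces that
  reassemble, without overlap, to sets on the right side; there are only \<open>2 \<theta> k\<close> of the latter, each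
  of value at most \<open>M\<close>, and every splitting or merging costs \<open>\<epsilon>\<close>. Using this for \<open>g\<close> with \<open>S\<close> and for
  \<open>- g\<close> with \<open>S'\<close> cancels \<open>g {}\<close> and bounds \<open>M\<close>.
\<close>

section \<open>Hall's marriage theorem\<close>

text \<open>Halmos-Vaughan induction on \<open>card I\<close>. If some nonempty proper subset
  \<open>J\<close> is tight, its matching uses up its whole neighbourhood, and the other indices
  still satisfy Hall's condition outside it. If none is tight, every nonempty proper subset has a
  spare element, so one index may be matched arbitrarily.\<close>

lemma hall_matching:
  assumes "finite I"
    and "\<And>i. i \<in> I \<Longrightarrow> finite (A i)"
    and "\<And>J. J \<subseteq> I \<Longrightarrow> card J \<le> card (\<Union>(A ` J))"
  shows "\<exists>m. inj_on m I \<and> (\<forall>i\<in>I. m i \<in> A i)"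
  using assms
proof (induction "card I" arbitrary: I A rule: less_induct)
  case less
  show ?case
  proof (cases "\<exists>J. J \<subset> I \<and> J \<noteq> {} \<and> card (\<Union>(A ` J)) = card J")
    case True
    then obtain J where J: "J \<subset> I" "J \<noteq> {}" "card (\<Union>(A ` J)) = card J" by blast
    define X where "X = \<Union>(A ` J)"
    have finJ: "finite J" using J(1) less.prems(1) by (meson finite_subset psubset_imp_subset)
    have finX: "finite X" unfolding X_def using J less.prems(2) finJ by auto
    have "card J < card I" using J(1) less.prems(1) by (rule psubset_card_mono[rotated])
    then have "\<exists>m. inj_on m J \<and> (\<forall>i\<in>J. m i \<in> A i)"
      using J(1) less.prems finJ by (intro less.hyps) auto
    then obtain m\<^sub>1 where m1: "inj_on m\<^sub>1 J" "\<forall>i\<in>J. m\<^sub>1 i \<in> A i" by blast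
    have "\<exists>m. inj_on m (I - J) \<and> (\<forall>i\<in>I - J. m i \<in> A i - X)"
    proof (rule less.hyps)
      show "card (I - J) < card I"
        using J less.prems(1) by (intro psubset_card_mono) auto
      fix L assume L: "L \<subseteq> I - J"
      have finL: "finite L" using L less.prems(1) by (meson finite_Diff finite_subset)
      have finAL: "finite (\<Union>((\<lambda>i. A i - X) ` L))"
        using L finL less.prems(2) by auto
      \<comment> \<open>Hall's condition for \<open>L \<union> J\<close>, minus the tightness of
        \<open>J\<close>, is Hall's condition for \<open>L\<close> once \<open>X\<close> is
        deleted.\<close>
      have "card L + card J = card (L \<union> J)"
        using L finL finJ by (intro card_Un_disjoint[symmetric]) auto
      also have "\<dots> \<le> card (\<Union>(A ` (L \<union> J)))"
        using L J(1) by (intro less.prems(3)) auto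
      also have "\<Union>(A ` (L \<union> J)) = \<Union>((\<lambda>i. A i - X) ` L) \<union> X"
        unfolding X_def by auto
      also have "card \<dots> = card (\<Union>((\<lambda>i. A i - X) ` L)) + card X"
        using finAL finX by (intro card_Un_disjoint) auto
      finally show "card L \<le> card (\<Union>((\<lambda>i. A i - X) ` L))"
        using J(3) X_def by simp
    qed (use less.prems in auto)
    then obtain m\<^sub>2 where m2: "inj_on m\<^sub>2 (I - J)" "\<forall>i\<in>I - J. m\<^sub>2 i \<in> A i - X" by blast
    define m where "m i = (if i \<in> J then m\<^sub>1 i else m\<^sub>2 i)" for i
    have sep: "m\<^sub>1 i \<noteq> m\<^sub>2 j" if "i \<in> J" "j \<in> I - J" for i j
    proof -
      have "m\<^sub>1 i \<in> X" using that(1) m1(2) by (auto simp: X_def)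
      moreover have "m\<^sub>2 j \<notin> X" using that(2) m2(2) by simp
      ultimately show ?thesis by metis
    qed
    have "inj_on m I"
    proof (rule inj_onI)
      fix i j assume "i \<in> I" "j \<in> I" "m i = m j"
      then show "i = j"
        using m1(1) m2(1) sep[of i j] sep[of j i]
        by (cases "i \<in> J"; cases "j \<in> J") (auto simp: m_def inj_on_def)
    qed
    moreover have "\<forall>i\<in>I. m i \<in> A i"
      using m1(2) m2(2) J(1) unfolding m_def by auto
    ultimately show ?thesis by blast
  next
    case False
    show ?thesis
    proof (cases "I = {}")
      case True
      then show ?thesis by simp
    next
      case False
      then obtain i where i: "i \<in> I" by blast
      have "card {i} \<le> card (\<Union>(A ` {i}))" using i by (intro less.prems(3)) auto
      then have "A i \<noteq> {}" by auto
      then obtain y where y: "y \<in> A i" by blast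
      have "\<exists>m. inj_on m (I - {i}) \<and> (\<forall>j\<in>I - {i}. m j \<in> A j - {y})"
      proof (rule less.hyps)
        show "card (I - {i}) < card I"
          using i less.prems(1) by (intro psubset_card_mono) auto
        fix L assume L: "L \<subseteq> I - {i}"
        show "card L \<le> card (\<Union>((\<lambda>j. A j - {y}) ` L))"
        proof (cases "L = {}")
          case False
          have "card L \<le> card (\<Union>(A ` L))" using L by (intro less.prems(3)) auto
          moreover have "card (\<Union>(A ` L)) \<noteq> card L"
            using \<open>\<not> (\<exists>J. J \<subset> I \<and> J \<noteq> {} \<and> card (\<Union>(A ` J)) = card J)\<close> L False i by blast
          moreover have "\<Union>((\<lambda>j. A j - {y}) ` L) = \<Union>(A ` L) - {y}" by auto
          ultimately show ?thesis by (auto simp: card_Diff_singleton_if)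
        qed simp
      qed (use less.prems in auto)
      then obtain m where m: "inj_on m (I - {i})" "\<forall>j\<in>I - {i}. m j \<in> A j - {y}" by blast
      have "inj_on (m(i := y)) I"
        using m by (auto simp: inj_on_def split: if_splits)
      moreover have "\<forall>j\<in>I. (m(i := y)) j \<in> A j" using m(2) y by auto
      ultimately show ?thesis by blast
    qed
  qed
qed

section \<open>A theorem of the alternative over the integers\<close>

text \<open>Supplies the value of the eliminated coordinate in the Fourier-Motzkin step below.
  Either set may be empty, since lower or upper bounds on that coordinate may be absent.\<close>

lemma finite_separation:
  fixes X Y :: "real set"
  assumes "finite X" "finite Y" and "\<And>x y. x \<in> X \<Longrightarrow> y \<in> Y \<Longrightarrow> x < y"
  obtains t where "\<And>x. x \<in> X \<Longrightarrow> x < t" "\<And>y. y \<in> Y \<Longrightarrow> t < y"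
proof (cases "X = {}")
  case True
  show ?thesis
  proof (cases "Y = {}")
    case True
    with \<open>X = {}\<close> that show ?thesis by auto
  next
    case False
    have "Min Y - 1 < y" if "y \<in> Y" for y
      using Min_le[OF assms(2) that] by linarith
    with \<open>X = {}\<close> that show ?thesis by blast
  qed
next
  case X: False
  show ?thesis
  proof (cases "Y = {}")
    case True
    have "x < Max X + 1" if "x \<in> X" for x
      using Max_ge[OF assms(1) that] by linarith
    with True that show ?thesis by blast
  next
    case False
    have "Max X < Min Y" using assms X False by (simp add: Max_in Min_in)
    then obtain t where t: "Max X < t" "t < Min Y" using dense by blast
    show ?thesis
    proof (rule that)
      show "x < t" if "x \<in> X" for x using Max_ge[OF assms(1) that] t(1) by linarith
      show "t < y" if "y \<in> Y" for y using Min_le[OF assms(2) that] t(2) by linarith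
    qed
  qed
qed

text \<open>Gordan's alternative over the integers, by Fourier--Motzkin elimination of the last coordinate.
  Integer multipliers are needed because they become multiplicities of sets; they are encoded as
  repetitions in a list.\<close>

lemma integer_gordan:
  fixes A :: "(nat \<Rightarrow> int) set"
  assumes "finite A"
  shows "(\<exists>xs. xs \<noteq> [] \<and> set xs \<subseteq> A \<and> (\<forall>j<n. (\<Sum>a\<leftarrow>xs. a j) = 0)) \<or>
         (\<exists>y :: nat \<Rightarrow> real. \<forall>a\<in>A. (\<Sum>j<n. y j * a j) > 0)"
  using assms
proof (induction n arbitrary: A)
  case 0
  show ?case
  proof (cases "A = {}")
    case False
    then obtain a where "a \<in> A" by blast
    then have "[a] \<noteq> [] \<and> set [a] \<subseteq> A" by simp
    then show ?thesis by blast
  qed simp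
next
  case (Suc n)
  \<comment> \<open>For \<open>p \<in> P\<close> and \<open>q \<in> Q\<close> both
    \<open>p n\<close> and \<open>- q n\<close> are positive, so this is a positive integer
    combination of \<open>q\<close> and \<open>p\<close>, chosen so that coordinate \<open>n\<close>
    cancels.\<close>
  define comb where "comb p q = (\<lambda>j. p n * q j - q n * p j)" for p q :: "nat \<Rightarrow> int"
  define Z P Q where "Z = {a\<in>A. a n = 0}" and "P = {a\<in>A. a n > 0}" and "Q = {a\<in>A. a n < 0}"
  define B where "B = Z \<union> (\<lambda>(p, q). comb p q) ` (P \<times> Q)"
  have fin: "finite Z" "finite P" "finite Q" using Suc.prems by (simp_all add: Z_def P_def Q_def)
  then have "finite B" by (simp add: B_def)
  from Suc.IH[OF this] show ?case
  proof
    assume "\<exists>xs. xs \<noteq> [] \<and> set xs \<subseteq> B \<and> (\<forall>j<n. (\<Sum>a\<leftarrow>xs. a j) = 0)"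
    then obtain xs where xs: "xs \<noteq> []" "set xs \<subseteq> B" "\<And>j. j < n \<Longrightarrow> (\<Sum>a\<leftarrow>xs. a j) = 0"
      by blast
    \<comment> \<open>Each vector of \<open>B\<close> unfolds into a list over \<open>A\<close>,
      with \<open>p n\<close> copies of \<open>q\<close> and \<open>- q n\<close> copies of
      \<open>p\<close> for \<open>comb p q\<close>. This turns a relation over \<open>B\<close> into
      one over \<open>A\<close>.\<close>
    have "\<exists>L. L \<noteq> [] \<and> set L \<subseteq> A \<and> (\<forall>j. (\<Sum>a\<leftarrow>L. a j) = b j) \<and> b n = 0" if b: "b \<in> B" for b
    proof (cases "b \<in> Z")
      case True
      then show ?thesis by (intro exI[of _ "[b]"]) (auto simp: Z_def)
    next
      case False
      then obtain p q where pq: "p \<in> P" "q \<in> Q" "b = comb p q" using b by (auto simp: B_def)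
      show ?thesis
        by (rule exI[of _ "replicate (nat (p n)) q @ replicate (nat (- q n)) p"])
          (use pq in \<open>auto simp: P_def Q_def comb_def sum_list_replicate\<close>)
    qed
    then obtain L where L: "\<And>b. b \<in> B \<Longrightarrow> L b \<noteq> [] \<and> set (L b) \<subseteq> A \<and>
        (\<forall>j. (\<Sum>a\<leftarrow>L b. a j) = b j) \<and> b n = 0"
      by metis
    have sum: "(\<Sum>a\<leftarrow>concat (map L xs). a j) = (\<Sum>b\<leftarrow>xs. b j)" for j
      using xs(2) L by (induction xs) auto
    have "(\<Sum>b\<leftarrow>xs. b n) = 0"
      using xs(2) L by (induction xs) auto
    then have "\<forall>j<Suc n. (\<Sum>a\<leftarrow>concat (map L xs). a j) = 0"
      using xs(3) unfolding sum by (auto simp: less_Suc_eq)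
    moreover have "concat (map L xs) \<noteq> []" using xs(1,2) L by (cases xs) auto
    moreover have "set (concat (map L xs)) \<subseteq> A" using xs(2) L by auto
    ultimately show ?thesis by blast
  next
    assume "\<exists>y :: nat \<Rightarrow> real. \<forall>a\<in>B. (\<Sum>j<n. y j * a j) > 0"
    then obtain y :: "nat \<Rightarrow> real" where y: "\<And>b. b \<in> B \<Longrightarrow> (\<Sum>j<n. y j * b j) > 0" by blast
    define d where "d a = (\<Sum>j<n. y j * a j)" for a :: "nat \<Rightarrow> int"
    have dcomb: "d (comb p q) = p n * d q - q n * d p" for p q
      unfolding d_def comb_def
      by (simp add: sum_distrib_left sum_subtractf algebra_simps)
    \<comment> \<open>With \<open>t\<close> as last coefficient, positivity on \<open>a\<close>
      reads \<open>d a + t * a n > 0\<close>: a lower bound on \<open>t\<close> for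
      \<open>a \<in> P\<close>, an upper bound for \<open>a \<in> Q\<close>. Positivity on
      \<open>comb p q\<close> says exactly that each lower bound lies below each upper
      bound.\<close>
    have lt: "- d p / p n < - d q / q n" if "p \<in> P" "q \<in> Q" for p q
    proof -
      have "comb p q \<in> B" using that by (auto simp: B_def)
      then have "d (comb p q) > 0" using y d_def by simp
      moreover have "p n > 0" "q n < 0" using that by (auto simp: P_def Q_def)
      ultimately show ?thesis unfolding dcomb by (simp add: field_simps)
    qed
    obtain t where t': "\<And>x. x \<in> (\<lambda>p. - d p / p n) ` P \<Longrightarrow> x < t"
        "\<And>x. x \<in> (\<lambda>q. - d q / q n) ` Q \<Longrightarrow> t < x"
      by (rule finite_separation[of "(\<lambda>p. - d p / p n) ` P" "(\<lambda>q. - d q / q n) ` Q"])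
        (use fin lt in auto)
    have t: "- d p / p n < t" if "p \<in> P" for p using t'(1) that by blast
    have t2: "t < - d q / q n" if "q \<in> Q" for q using t'(2) that by blast
    have "(\<Sum>j<Suc n. (y(n := t)) j * a j) > 0" if a: "a \<in> A" for a
    proof -
      have "(\<Sum>j<n. (y(n := t)) j * a j) = d a" unfolding d_def by (intro sum.cong) auto
      then have eq: "(\<Sum>j<Suc n. (y(n := t)) j * a j) = d a + t * a n" by simp
      consider "a n = 0" | "a n > 0" | "a n < 0" by linarith
      then show ?thesis
      proof cases
        case 1
        then have "a \<in> B" using a by (simp add: B_def Z_def)
        then have "d a > 0" using y d_def by simp
        with 1 eq show ?thesis by simp
      next
        case 2
        then have "- d a / a n < t" using a t by (simp add: P_def)
        with 2 eq show ?thesis by (simp add: field_simps)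
      next
        case 3
        then have "t < - d a / a n" using a t2 by (simp add: Q_def)
        with 3 eq show ?thesis by (simp add: field_simps)
      qed
    qed
    then show ?thesis by blast
  qed
qed

section \<open>Splitting and merging along an expander\<close>

text \<open>Each of the \<open>card D - 1\<close> merges applies approximate modularity to disjoint
  sets, whose intersection contributes \<open>g {}\<close>. Normalising every value by
  \<open>g {}\<close> makes the main terms additive.\<close>

lemma approx_modular_disjoint_UN:
  assumes am: "approx_modular n \<epsilon> g"
    and "finite D" "D \<noteq> {}" and "\<And>w. w \<in> D \<Longrightarrow> A w \<subseteq> {1..n}" and "disjoint_family_on A D"
  shows "\<bar>(g (\<Union>(A ` D)) - g {}) - (\<Sum>w\<in>D. g (A w) - g {})\<bar> \<le> (real (card D) - 1) * \<epsilon>"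
  using assms(2-)
proof (induction D rule: finite_ne_induct)
  case (singleton x)
  then show ?case by simp
next
  case (insert x F)
  have IH: "\<bar>(g (\<Union>(A ` F)) - g {}) - (\<Sum>w\<in>F. g (A w) - g {})\<bar> \<le> (real (card F) - 1) * \<epsilon>"
    using insert.prems by (intro insert.IH) (auto simp: disjoint_family_on_def)
  have "A x \<inter> \<Union>(A ` F) = {}"
    using insert.prems(2) insert.hyps by (auto simp: disjoint_family_on_def)
  moreover have "A x \<subseteq> {1..n}" "\<Union>(A ` F) \<subseteq> {1..n}" using insert.prems(1) by auto
  ultimately have "\<bar>g (A x) + g (\<Union>(A ` F)) - g (A x \<union> \<Union>(A ` F)) - g {}\<bar> \<le> \<epsilon>"
    using am unfolding approx_modular_def by metis
  moreover have "(real (card (insert x F)) - 1) * \<epsilon> = (real (card F) - 1) * \<epsilon> + \<epsilon>"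
    using insert.hyps by (simp add: algebra_simps)
  ultimately show ?case using IH insert.hyps by simp
qed

text \<open>Splitting or merging at a vertex costs its degree minus one errors; summed over both
  sides this is \<open>2 * card E\<close> less the number of vertices involved. Only right vertices
  reached by an edge count, because a merge needs at least one piece. Since \<open>g\<close> is
  bounded only from above, the lemma applies to \<open>- g\<close> as well.\<close>

lemma expander_sum_bound:
  assumes ex: "is_expander \<alpha> r \<theta> k V W E" and ge1: "1 \<le> 2 * real k * \<alpha>"
    and am: "approx_modular n \<epsilon> g"
    and le: "\<And>S. S \<subseteq> {1..n} \<Longrightarrow> g S \<le> M"
    and T: "\<And>v. v \<in> V \<Longrightarrow> T v \<subseteq> {1..n}"
    and marg: "\<And>x. x \<in> {1..n} \<Longrightarrow> real (card {v\<in>V. x \<in> T v}) \<le> 2 * real k * \<alpha>"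
  shows "(\<Sum>v\<in>V. g (T v) - g {}) \<le> real (card (E `` V)) * (M - g {})
           + (2 * real (card E) - real (card V) - real (card (E `` V))) * \<epsilon>"
proof -
  have fin: "finite V" "finite W" "E \<subseteq> V \<times> W"
    and exp: "\<And>S. S \<subseteq> V \<Longrightarrow> real (card S) \<le> 2 * real k * \<alpha> \<Longrightarrow> card S \<le> card (E `` S)"
    using ex by (auto simp: is_expander_def)
  have finE: "finite E" using fin by (meson finite_SigmaI finite_subset)
  have finN: "finite (E `` S)" for S using finE by (simp add: finite_Image)
  define D where "D v = E `` {v}" for v
  define D' where "D' w = {v. (v, w) \<in> E}" for w
  have finD: "finite (D v)" for v unfolding D_def by (rule finN)
  have D'V: "D' w \<subseteq> V" for w using fin by (auto simp: D'_def)
  have finD': "finite (D' w)" for w using D'V fin(1) by (rule finite_subset)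
  \<comment> \<open>By \<open>ge1\<close> a single vertex is small enough to expand, hence has a
    neighbour.\<close>
  have Dne: "D v \<noteq> {}" if "v \<in> V" for v
    using exp[of "{v}"] that ge1 by (auto simp: D_def)
  have D'ne: "D' w \<noteq> {}" if "w \<in> E `` V" for w using that by (auto simp: D'_def)
  \<comment> \<open>By \<open>marg\<close>, few enough left sets contain \<open>x\<close> for the
    expansion property to apply to every subcollection, which is Hall's condition.\<close>
  have "\<forall>x\<in>{1..n}. \<exists>m. inj_on m {v\<in>V. x \<in> T v} \<and> (\<forall>v\<in>{v\<in>V. x \<in> T v}. m v \<in> D v)"
  proof (intro ballI hall_matching)
    fix x assume x: "x \<in> {1..n}"
    fix J assume J: "J \<subseteq> {v\<in>V. x \<in> T v}"
    then have "card J \<le> card {v\<in>V. x \<in> T v}" using fin(1) by (intro card_mono) auto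
    then have "card J \<le> card (E `` J)" using J marg[OF x] by (intro exp) auto
    also have "E `` J = \<Union>(D ` J)" by (auto simp: D_def)
    finally show "card J \<le> card (\<Union>(D ` J))" .
  qed (use fin(1) finD in auto)
  from bchoice[OF this] obtain m where "\<forall>x\<in>{1..n}.
      inj_on (m x) {v\<in>V. x \<in> T v} \<and> (\<forall>v\<in>{v\<in>V. x \<in> T v}. m x v \<in> D v)" ..
  then have m: "\<And>x. x \<in> {1..n} \<Longrightarrow> inj_on (m x) {v\<in>V. x \<in> T v}"
      "\<And>x v. x \<in> {1..n} \<Longrightarrow> v \<in> V \<Longrightarrow> x \<in> T v \<Longrightarrow> m x v \<in> D v"
    by auto
  \<comment> \<open>The part of \<open>T v\<close> sent along the edge from \<open>v\<close> to
    \<open>w\<close>. Pieces at one \<open>v\<close> are disjoint because each item takes one route,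
    pieces at one \<open>w\<close> because \<open>m x\<close> is injective.\<close>
  define A where "A v w = {x \<in> T v. m x v = w}" for v w
  have Asub: "A v w \<subseteq> {1..n}" if "v \<in> V" for v w using T[OF that] by (auto simp: A_def)
  have Tv: "T v = \<Union>(A v ` D v)" if "v \<in> V" for v
    using T[OF that] m(2) that by (auto simp: A_def)
  have v_bound: "g (T v) - g {} \<le> (\<Sum>w\<in>D v. g (A v w) - g {}) + (real (card (D v)) - 1) * \<epsilon>"
    if v: "v \<in> V" for v
  proof -
    have "disjoint_family_on (A v) (D v)" by (auto simp: disjoint_family_on_def A_def)
    from approx_modular_disjoint_UN[OF am finD Dne[OF v] Asub[OF v] this]
    show ?thesis unfolding Tv[OF v, symmetric] by linarith
  qed
  have w_bound: "(\<Sum>v\<in>D' w. g (A v w) - g {}) \<le> M - g {} + (real (card (D' w)) - 1) * \<epsilon>"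
    if w: "w \<in> E `` V" for w
  proof -
    have "disjoint_family_on (\<lambda>v. A v w) (D' w)"
      unfolding disjoint_family_on_def
    proof (intro ballI impI)
      fix u v assume uv: "u \<in> D' w" "v \<in> D' w" "u \<noteq> v"
      show "A u w \<inter> A v w = {}"
      proof (rule ccontr)
        assume "A u w \<inter> A v w \<noteq> {}"
        then obtain x where "x \<in> A u w" "x \<in> A v w" by blast
        then have "x \<in> T u" "x \<in> T v" "m x u = m x v" by (simp_all add: A_def)
        moreover have "u \<in> V" "v \<in> V" using uv D'V by auto
        ultimately show False using m(1)[of x] T[of u] uv(3) by (auto simp: inj_on_def)
      qed
    qed
    moreover have "\<And>v. v \<in> D' w \<Longrightarrow> A v w \<subseteq> {1..n}" using Asub D'V by blast
    moreover from this have "g (\<Union>v\<in>D' w. A v w) \<le> M" by (intro le) auto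
    ultimately show ?thesis
      using approx_modular_disjoint_UN[OF am finD' D'ne[OF w], of "\<lambda>v. A v w"] by auto
  qed
  \<comment> \<open>Double counting of edges: it evaluates the degree sums and regroups the pieces
    of left sets by right vertex.\<close>
  have by_v: "(\<Sum>v\<in>V. \<Sum>w\<in>D v. h v w) = (\<Sum>(v, w)\<in>E. h v w)" for h :: "_ \<Rightarrow> _ \<Rightarrow> real"
  proof -
    have "Sigma V D = E" using fin(3) by (auto simp: D_def)
    then show ?thesis using sum.Sigma[of V D h] fin(1) finD by simp
  qed
  have by_w: "(\<Sum>w\<in>E `` V. \<Sum>v\<in>D' w. h v w) = (\<Sum>(v, w)\<in>E. h v w)" for h :: "_ \<Rightarrow> _ \<Rightarrow> real"
  proof -
    have "Sigma (E `` V) D' = prod.swap ` E" using fin(3) by (force simp: D'_def)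
    then have "(\<Sum>w\<in>E `` V. \<Sum>v\<in>D' w. h v w) = (\<Sum>(w, v)\<in>prod.swap ` E. h v w)"
      using sum.Sigma[of "E `` V" D' "\<lambda>w v. h v w"] finN finD' by simp
    also have "\<dots> = (\<Sum>(v, w)\<in>E. h v w)"
      by (subst sum.reindex) (auto simp: inj_on_def case_prod_beta intro!: sum.cong)
    finally show ?thesis .
  qed
  have "(\<Sum>v\<in>V. real (card (D v))) = card E" using by_v[of "\<lambda>_ _. 1"] by (simp add: case_prod_beta)
  then have err_v: "(\<Sum>v\<in>V. (real (card (D v)) - 1) * \<epsilon>) = (real (card E) - card V) * \<epsilon>"
    by (simp flip: sum_distrib_right add: sum_subtractf)
  have "(\<Sum>w\<in>E `` V. real (card (D' w))) = card E"
    using by_w[of "\<lambda>_ _. 1"] by (simp add: case_prod_beta)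
  then have err_w: "(\<Sum>w\<in>E `` V. (real (card (D' w)) - 1) * \<epsilon>) = (real (card E) - card (E `` V)) * \<epsilon>"
    by (simp flip: sum_distrib_right add: sum_subtractf)
  have "(\<Sum>v\<in>V. g (T v) - g {})
      \<le> (\<Sum>v\<in>V. (\<Sum>w\<in>D v. g (A v w) - g {}) + (real (card (D v)) - 1) * \<epsilon>)"
    by (intro sum_mono v_bound)
  also have "\<dots> = (\<Sum>(v, w)\<in>E. g (A v w) - g {}) + (real (card E) - card V) * \<epsilon>"
    unfolding sum.distrib err_v by_v ..
  also have "(\<Sum>(v, w)\<in>E. g (A v w) - g {}) = (\<Sum>w\<in>E `` V. \<Sum>v\<in>D' w. g (A v w) - g {})"
    unfolding by_w ..
  also have "\<dots> \<le> (\<Sum>w\<in>E `` V. M - g {} + (real (card (D' w)) - 1) * \<epsilon>)"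
    by (intro sum_mono w_bound)
  also have "\<dots> = card (E `` V) * (M - g {}) + (real (card E) - card (E `` V)) * \<epsilon>"
    unfolding sum.distrib err_w by simp
  finally show ?thesis by (simp add: algebra_simps)
qed

section \<open>Residuals and best linear approximation\<close>

lemma approx_modularD:
  assumes "approx_modular n \<epsilon> f" "S \<subseteq> {1..n}" "T \<subseteq> {1..n}"
  shows "\<bar>f S + f T - f (S \<union> T) - f (S \<inter> T)\<bar> \<le> \<epsilon>"
  using assms unfolding approx_modular_def by blast

lemma linear_set_function_add:
  assumes "linear_set_function n l" "linear_set_function n l'"
  shows "linear_set_function n (\<lambda>S. l S + l' S)"
proof -
  obtain a c where "\<forall>S\<subseteq>{1..n}. l S = a + (\<Sum>i\<in>S. c i)"
    using assms(1) unfolding linear_set_function_def by blast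
  moreover obtain a' c' where "\<forall>S\<subseteq>{1..n}. l' S = a' + (\<Sum>i\<in>S. c' i)"
    using assms(2) unfolding linear_set_function_def by blast
  ultimately show ?thesis unfolding linear_set_function_def
    by (intro exI[of _ "a + a'"] exI[of _ "\<lambda>i. c i + c' i"]) (simp add: sum.distrib)
qed

lemma approx_modular_diff_linear:
  assumes "approx_modular n \<epsilon> f" "linear_set_function n l"
  shows "approx_modular n \<epsilon> (\<lambda>S. f S - l S)"
proof -
  obtain a c where l: "\<And>S. S \<subseteq> {1..n} \<Longrightarrow> l S = a + (\<Sum>i\<in>S. c i)"
    using assms(2) unfolding linear_set_function_def by blast
  have mod: "l S + l T = l (S \<union> T) + l (S \<inter> T)" if "S \<subseteq> {1..n}" "T \<subseteq> {1..n}" for S T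
  proof -
    have "finite S" "finite T" using that by (auto intro: finite_subset)
    from sum.union_inter[OF this, of c] show ?thesis
      using that by (simp add: l le_infI1)
  qed
  have "(f S - l S) + (f T - l T) - (f (S \<union> T) - l (S \<union> T)) - (f (S \<inter> T) - l (S \<inter> T))
      = f S + f T - f (S \<union> T) - f (S \<inter> T)" if "S \<subseteq> {1..n}" "T \<subseteq> {1..n}" for S T
    using mod[OF that] by linarith
  then show ?thesis using assms(1) unfolding approx_modular_def by metis
qed

lemma approx_modular_uminus:
  assumes "approx_modular n \<epsilon> g"
  shows "approx_modular n \<epsilon> (\<lambda>S. - g S)"
proof -
  have "\<bar>- g S + - g T - - g (S \<union> T) - - g (S \<inter> T)\<bar> = \<bar>g S + g T - g (S \<union> T) - g (S \<inter> T)\<bar>" for S T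
    by argo
  then show ?thesis using assms unfolding approx_modular_def by (simp only:)
qed

lemma approx_linear_mono:
  assumes "approx_linear n \<Delta> f" "\<Delta> \<le> \<Delta>'"
  shows "approx_linear n \<Delta>' f"
  using assms unfolding approx_linear_def by (meson order_trans)

text \<open>The infimum of the attainable errors is itself attainable by
  \<open>approx_linear_closed\<close>; the zero function shows that some error is
  attainable.\<close>

lemma exists_best_linear:
  obtains l M where "linear_set_function n l" "\<And>S. S \<subseteq> {1..n} \<Longrightarrow> \<bar>f S - l S\<bar> \<le> M"
    "\<And>\<Delta>. approx_linear n \<Delta> f \<Longrightarrow> M \<le> \<Delta>"
proof -
  define X where "X = {\<Delta>. approx_linear n \<Delta> f}"
  have "0 \<le> \<Delta>" if "\<Delta> \<in> X" for \<Delta>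
    using that unfolding X_def approx_linear_def by force
  then have bdd: "bdd_below X" by (rule bdd_belowI)
  define B where "B = Max ((\<lambda>S. \<bar>f S\<bar>) ` Pow {1..n})"
  have "\<bar>f S\<bar> \<le> B" if "S \<subseteq> {1..n}" for S
    unfolding B_def using that by (intro Max_ge) auto
  moreover have "linear_set_function n (\<lambda>_. 0)"
    unfolding linear_set_function_def by (intro exI[of _ 0] exI[of _ "\<lambda>_. 0"]) simp
  ultimately have "B \<in> X" unfolding X_def approx_linear_def mem_Collect_eq
    by (intro exI[of _ "\<lambda>_. 0"]) simp
  then have ne: "X \<noteq> {}" by blast
  have "approx_linear n (Inf X) f"
  proof (rule approx_linear_closed)
    fix \<Delta>' assume "\<Delta>' > Inf X"
    then obtain \<Delta> where "\<Delta> \<in> X" "\<Delta> < \<Delta>'" using cInf_less_iff[OF ne bdd] by blast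
    then show "approx_linear n \<Delta>' f"
      unfolding X_def by (auto intro: approx_linear_mono)
  qed
  then obtain l where "linear_set_function n l" "\<And>S. S \<subseteq> {1..n} \<Longrightarrow> \<bar>f S - l S\<bar> \<le> Inf X"
    unfolding approx_linear_def by blast
  moreover have "Inf X \<le> \<Delta>" if "approx_linear n \<Delta> f" for \<Delta>
    using that bdd by (intro cInf_lower) (simp_all add: X_def)
  ultimately show ?thesis by (rule that)
qed

text \<open>First-order argument: subtracting a small positive multiple of \<open>l\<close> lowers
  \<open>\<bar>g S\<bar>\<close> wherever it equals \<open>M\<close>, and elsewhere the gap to
  \<open>M\<close> absorbs the change. There are finitely many sets, so one multiple serves them
  all.\<close>

lemma approx_linear_improve:
  fixes y\<^sub>0 :: real and y :: "nat \<Rightarrow> real"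
  defines "l \<equiv> \<lambda>S. y\<^sub>0 + (\<Sum>i\<in>S. y i)"
  assumes "M > 0" and bound: "\<And>S. S \<subseteq> {1..n} \<Longrightarrow> \<bar>g S\<bar> \<le> M"
    and pos: "\<And>S. S \<subseteq> {1..n} \<Longrightarrow> g S = M \<Longrightarrow> l S > 0"
    and neg: "\<And>S. S \<subseteq> {1..n} \<Longrightarrow> g S = - M \<Longrightarrow> l S < 0"
  shows "\<exists>\<Delta><M. approx_linear n \<Delta> g"
proof -
  have "\<forall>\<^sub>F t in at_right 0. \<bar>g S - t * l S\<bar> < M" if S: "S \<subseteq> {1..n}" for S
  proof -
    have gt: "\<forall>\<^sub>F t in at_right (0::real). 0 < t" by (rule eventually_at_right_less)
    have "((\<lambda>t. t * l S) \<longlongrightarrow> 0 * l S) (at_right 0)" by (intro tendsto_intros)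
    then have lim: "((\<lambda>t. \<bar>t * l S\<bar>) \<longlongrightarrow> 0) (at_right 0)"
      using tendsto_rabs_zero by fastforce
    consider "g S = M" | "g S = - M" | "\<bar>g S\<bar> < M" using bound[OF S] by linarith
    then show ?thesis
    proof cases
      case 1
      have "\<forall>\<^sub>F t in at_right 0. \<bar>t * l S\<bar> < M" using order_tendstoD(2)[OF lim] \<open>M > 0\<close> .
      with gt show ?thesis
      proof eventually_elim
        case (elim t)
        have "t * l S > 0" using elim(1) pos[OF S 1] by simp
        with elim(2) 1 show ?case by linarith
      qed
    next
      case 2
      have "\<forall>\<^sub>F t in at_right 0. \<bar>t * l S\<bar> < M" using order_tendstoD(2)[OF lim] \<open>M > 0\<close> .
      with gt show ?thesis
      proof eventually_elim
        case (elim t)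
        have "t * l S < 0" using elim(1) neg[OF S 2] by (simp add: mult_pos_neg)
        with elim(2) 2 show ?case by linarith
      qed
    next
      case 3
      then have "\<forall>\<^sub>F t in at_right 0. \<bar>t * l S\<bar> < M - \<bar>g S\<bar>"
        by (intro order_tendstoD(2)[OF lim]) simp
      then show ?thesis by eventually_elim linarith
    qed
  qed
  then have "\<forall>\<^sub>F t in at_right 0. \<forall>S\<in>Pow {1..n}. \<bar>g S - t * l S\<bar> < M"
    by (intro eventually_ball_finite) auto
  then obtain t where t: "\<And>S. S \<subseteq> {1..n} \<Longrightarrow> \<bar>g S - t * l S\<bar> < M"
    using eventually_happens'[OF trivial_limit_at_right_real] by blast
  define \<Delta> where "\<Delta> = Max ((\<lambda>S. \<bar>g S - t * l S\<bar>) ` Pow {1..n})"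
  have "\<Delta> < M" unfolding \<Delta>_def using t by (subst Max_less_iff) auto
  moreover have "\<bar>g S - t * l S\<bar> \<le> \<Delta>" if "S \<subseteq> {1..n}" for S
    unfolding \<Delta>_def using that by (intro Max_ge) auto
  moreover have "linear_set_function n (\<lambda>S. t * l S)"
    unfolding linear_set_function_def l_def
    by (intro exI[of _ "t * y\<^sub>0"] exI[of _ "\<lambda>i. t * y i"]) (simp add: sum_distrib_left algebra_simps)
  ultimately show ?thesis unfolding approx_linear_def by metis
qed

section \<open>Extremal families from optimality\<close>

text \<open>Gordan's alternative for signed incidence vectors of the sets where
  \<open>\<bar>g S\<bar> = M\<close>: a vanishing combination gives the balanced families, while a
  strictly positive functional would be a direction of improvement, contradicting
  \<open>best\<close>.\<close>

lemma extremal_families: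
  assumes "M > 0" and bound: "\<forall>S\<subseteq>{1..n}. \<bar>g S\<bar> \<le> M"
    and best: "\<forall>\<Delta>. approx_linear n \<Delta> g \<longrightarrow> M \<le> \<Delta>"
  obtains m :: nat and P N :: "nat \<Rightarrow> nat set" where "m > 0"
    "\<forall>i<m. P i \<subseteq> {1..n} \<and> g (P i) = M"
    "\<forall>i<m. N i \<subseteq> {1..n} \<and> g (N i) = - M"
    "\<forall>x\<in>{1..n}. (\<Sum>i<m. of_bool (x \<in> P i)) = (\<Sum>i<m. of_bool (x \<in> N i) :: real)"
proof -
  note bound = bound[rule_format]
  define I where "I = {S. S \<subseteq> {1..n} \<and> \<bar>g S\<bar> = M}"
  \<comment> \<open>Coordinate \<open>0\<close> counts the set itself, so its vanishing makes the
    two families equally long; coordinate \<open>j\<close> balances item \<open>j\<close>. In the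
    other alternative, \<open>y 0\<close> becomes the constant term of the linear function.\<close>
  define vec where "vec S = (\<lambda>j::nat. (if g S = M then 1 else - 1) *
    (if j = 0 then 1 else of_bool (j \<in> S)) :: int)" for S
  have "finite I" unfolding I_def by simp
  then have "finite (vec ` I)" by simp
  from integer_gordan[OF this, of "Suc n"] show thesis
  proof
    assume "\<exists>xs. xs \<noteq> [] \<and> set xs \<subseteq> vec ` I \<and> (\<forall>j<Suc n. (\<Sum>a\<leftarrow>xs. a j) = 0)"
    then obtain xs where xs: "xs \<noteq> []" "set xs \<subseteq> vec ` I" "\<And>j. j < Suc n \<Longrightarrow> (\<Sum>a\<leftarrow>xs. a j) = 0"
      by blast
    define L where "L = map (inv_into I vec) xs"
    have "map vec L = xs"
      unfolding L_def map_map using xs(2) by (intro map_idI) (auto simp: f_inv_into_f subset_eq)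
    then have L0: "(\<Sum>S\<leftarrow>L. vec S j) = 0" if "j < Suc n" for j
      using xs(3)[OF that] unfolding \<open>map vec L = xs\<close>[symmetric] by (simp add: o_def)
    have LI: "set L \<subseteq> I" unfolding L_def using xs(2) by (auto intro: inv_into_into)
    define ps ns where "ps = filter (\<lambda>S. g S = M) L" and "ns = filter (\<lambda>S. g S \<noteq> M) L"
    have "(\<Sum>S\<leftarrow>L. vec S 0) = int (length ps) - int (length ns)"
      unfolding ps_def ns_def vec_def by (induction L) auto
    then have len: "length ns = length ps" using L0[of 0] by simp
    have "length L = length ps + length ns"
      unfolding ps_def ns_def by (induction L) auto
    then have "length ps > 0" using len xs(1) unfolding L_def by auto
    moreover have "ps ! i \<subseteq> {1..n} \<and> g (ps ! i) = M" if "i < length ps" for i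
      using nth_mem[OF that] LI unfolding ps_def I_def by auto
    moreover have "ns ! i \<subseteq> {1..n} \<and> g (ns ! i) = - M" if "i < length ps" for i
      using nth_mem[of i ns] that len LI unfolding ns_def I_def by auto
    moreover have "(\<Sum>i<length ps. of_bool (x \<in> ps ! i)) = (\<Sum>i<length ps. of_bool (x \<in> ns ! i) :: real)"
      if x: "x \<in> {1..n}" for x
    proof -
      have "real_of_int (\<Sum>S\<leftarrow>L. vec S x) = (\<Sum>S\<leftarrow>ps. of_bool (x \<in> S)) - (\<Sum>S\<leftarrow>ns. of_bool (x \<in> S))"
        unfolding ps_def ns_def vec_def using x by (induction L) auto
      then show ?thesis
        using L0[of x] x by (simp add: sum_list_sum_nth[of "map _ ps"] sum_list_sum_nth[of "map _ ns"]
            len atLeast0LessThan)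
    qed
    ultimately show thesis using that[of "length ps" "(!) ps" "(!) ns"] by blast
  next
    assume "\<exists>y :: nat \<Rightarrow> real. \<forall>a\<in>vec ` I. (\<Sum>j<Suc n. y j * a j) > 0"
    then obtain y :: "nat \<Rightarrow> real" where y: "\<And>S. S \<in> I \<Longrightarrow> (\<Sum>j<Suc n. y j * vec S j) > 0"
      by blast
    define l where "l S = y 0 + (\<Sum>i\<in>S. y i)" for S
    have yl: "(\<Sum>j<Suc n. y j * vec S j) = (if g S = M then 1 else - 1) * l S" if "S \<subseteq> {1..n}" for S
    proof -
      have "(\<Sum>i\<in>S. y i) = (\<Sum>j\<in>{1..n}. y j * of_bool (j \<in> S))"
        using that by (intro sum.mono_neutral_cong_left) auto
      also have "\<dots> = (\<Sum>j<n. y (Suc j) * of_bool (Suc j \<in> S))"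
        unfolding One_nat_def sum.atLeast1_atMost_eq ..
      finally show ?thesis
        by (subst sum.lessThan_Suc_shift) (auto simp: vec_def l_def sum_negf)
    qed
    have "\<exists>\<Delta><M. approx_linear n \<Delta> g"
    proof (rule approx_linear_improve[OF \<open>M > 0\<close> bound])
      show "0 < y 0 + sum y S" if "S \<subseteq> {1..n}" "g S = M" for S
        using y[of S] yl[of S] that \<open>M > 0\<close> by (simp add: I_def l_def del: sum.lessThan_Suc)
      show "y 0 + sum y S < 0" if "S \<subseteq> {1..n}" "g S = - M" for S
        using y[of S] yl[of S] that \<open>M > 0\<close> by (simp add: I_def l_def del: sum.lessThan_Suc)
    qed
    with best show thesis by (meson linorder_not_less)
  qed
qed

section \<open>Paired families with small item frequencies\<close>

text \<open>Here \<open>\<delta>\<close> is half the average shortfall of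
  \<open>g (S i) - g (S' i)\<close> from its ideal value \<open>2 * M\<close>, in units of
  \<open>\<epsilon>\<close>. Controlling the difference alone lets unknown terms such as
  \<open>g {}\<close> cancel.\<close>

definition paired_family ::
  "nat \<Rightarrow> real \<Rightarrow> (nat set \<Rightarrow> real) \<Rightarrow> real \<Rightarrow> 'i set \<Rightarrow> ('i \<Rightarrow> nat set) \<Rightarrow> ('i \<Rightarrow> nat set) \<Rightarrow>
    real \<Rightarrow> real \<Rightarrow> bool" where
  "paired_family n \<epsilon> g M I S S' \<alpha> \<delta> \<longleftrightarrow>
     finite I \<and> I \<noteq> {} \<and> (\<forall>i\<in>I. S i \<subseteq> {1..n} \<and> S' i \<subseteq> {1..n}) \<and>
     (\<forall>x\<in>{1..n}. (\<Sum>i\<in>I. of_bool (x \<in> S i)) \<le> \<alpha> * real (card I)) \<and>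
     (\<forall>x\<in>{1..n}. (\<Sum>i\<in>I. of_bool (x \<in> S' i)) \<le> \<alpha> * real (card I)) \<and>
     (\<Sum>i\<in>I. g (S i) - g (S' i)) \<ge> 2 * real (card I) * (M - \<delta> * \<epsilon>)"

lemma paired_family_mono:
  assumes "paired_family n \<epsilon> g M I S S' \<alpha> \<delta>" "\<alpha> \<le> \<alpha>'"
  shows "paired_family n \<epsilon> g M I S S' \<alpha>' \<delta>"
proof -
  have "\<alpha> * card I \<le> \<alpha>' * card I" using assms(2) by (simp add: mult_right_mono)
  then show ?thesis using assms(1) unfolding paired_family_def by fastforce
qed

text \<open>Independent choice of \<open>i\<close> and \<open>j\<close> multiplies frequencies.
  Since unions have value at most \<open>M\<close>, \<open>g (S i \<inter> T j)\<close> is at least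
  \<open>g (S i) + g (T j) - M - \<epsilon>\<close>, and likewise for \<open>- g\<close> on the
  primed sets; the two errors \<open>\<epsilon>\<close> add one to
  \<open>\<delta> + \<gamma>\<close>.\<close>

lemma paired_family_Int:
  assumes am: "approx_modular n \<epsilon> g" and bound: "\<forall>S\<subseteq>{1..n}. \<bar>g S\<bar> \<le> M"
    and S: "paired_family n \<epsilon> g M I S S' \<alpha> \<delta>" and T: "paired_family n \<epsilon> g M J T T' \<beta> \<gamma>"
  shows "paired_family n \<epsilon> g M (I \<times> J) (\<lambda>(i, j). S i \<inter> T j) (\<lambda>(i, j). S' i \<inter> T' j)
           (\<alpha> * \<beta>) (\<delta> + \<gamma> + 1)"
proof -
  note bound = bound[rule_format]
  have fin: "finite I" "finite J"
    and Ssub: "\<And>i. i \<in> I \<Longrightarrow> S i \<subseteq> {1..n}" "\<And>i. i \<in> I \<Longrightarrow> S' i \<subseteq> {1..n}"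
    and Tsub: "\<And>j. j \<in> J \<Longrightarrow> T j \<subseteq> {1..n}" "\<And>j. j \<in> J \<Longrightarrow> T' j \<subseteq> {1..n}"
    using S T by (auto simp: paired_family_def)
  have marg: "(\<Sum>(i, j)\<in>I \<times> J. of_bool (x \<in> A i \<inter> B j)) \<le> \<alpha> * \<beta> * card (I \<times> J)"
    if "(\<Sum>i\<in>I. of_bool (x \<in> A i)) \<le> \<alpha> * card I" "(\<Sum>j\<in>J. of_bool (x \<in> B j)) \<le> \<beta> * card J"
    for A B x
  proof -
    have "(\<Sum>(i, j)\<in>I \<times> J. of_bool (x \<in> A i \<inter> B j))
        = (\<Sum>i\<in>I. of_bool (x \<in> A i)) * (\<Sum>j\<in>J. of_bool (x \<in> B j) :: real)"
      by (simp add: sum_product sum.cartesian_product of_bool_conj)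
    also have "\<dots> \<le> (\<alpha> * card I) * (\<beta> * card J)"
      using that by (intro mult_mono) (auto intro: sum_nonneg order_trans[OF sum_nonneg that(1)])
    finally show ?thesis by (simp add: card_cartesian_product algebra_simps)
  qed
  have "(\<Sum>(i, j)\<in>I \<times> J. (g (S i) - g (S' i)) + (g (T j) - g (T' j)) - 2 * (M + \<epsilon>))
      \<le> (\<Sum>(i, j)\<in>I \<times> J. g (S i \<inter> T j) - g (S' i \<inter> T' j))"
  proof (intro sum_mono, unfold split_paired_all prod.case mem_Times_iff fst_conv snd_conv, elim conjE)
    fix i j assume ij: "i \<in> I" "j \<in> J"
    have "g (S i) + g (T j) - g (S i \<union> T j) - g (S i \<inter> T j) \<le> \<epsilon>"
      using approx_modularD[OF am Ssub(1)[OF ij(1)] Tsub(1)[OF ij(2)]] by (rule abs_le_D1)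
    moreover have "- (g (S' i) + g (T' j) - g (S' i \<union> T' j) - g (S' i \<inter> T' j)) \<le> \<epsilon>"
      using approx_modularD[OF am Ssub(2)[OF ij(1)] Tsub(2)[OF ij(2)]] by (rule abs_le_D2)
    moreover have "g (S i \<union> T j) \<le> M"
      using Ssub(1)[OF ij(1)] Tsub(1)[OF ij(2)] by (intro abs_le_D1[OF bound]) simp
    moreover have "- g (S' i \<union> T' j) \<le> M"
      using Ssub(2)[OF ij(1)] Tsub(2)[OF ij(2)] by (intro abs_le_D2[OF bound]) simp
    ultimately show "(g (S i) - g (S' i)) + (g (T j) - g (T' j)) - 2 * (M + \<epsilon>)
        \<le> g (S i \<inter> T j) - g (S' i \<inter> T' j)" by argo
  qed
  moreover have "(\<Sum>(i, j)\<in>I \<times> J. (g (S i) - g (S' i)) + (g (T j) - g (T' j)) - 2 * (M + \<epsilon>))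
      = card J * (\<Sum>i\<in>I. g (S i) - g (S' i)) + card I * (\<Sum>j\<in>J. g (T j) - g (T' j))
        - 2 * (M + \<epsilon>) * (card I * card J)"
    by (simp only: sum.cartesian_product[symmetric] sum.distrib sum_subtractf sum_constant sum_distrib_left)
      (simp add: sum_subtractf sum_distrib_left algebra_simps)
  moreover have "card J * (2 * card I * (M - \<delta> * \<epsilon>)) \<le> card J * (\<Sum>i\<in>I. g (S i) - g (S' i))"
    "card I * (2 * card J * (M - \<gamma> * \<epsilon>)) \<le> card I * (\<Sum>j\<in>J. g (T j) - g (T' j))"
    using S T by (auto simp: paired_family_def intro!: mult_left_mono)
  ultimately have "2 * real (card (I \<times> J)) * (M - (\<delta> + \<gamma> + 1) * \<epsilon>)
      \<le> (\<Sum>(i, j)\<in>I \<times> J. g (S i \<inter> T j) - g (S' i \<inter> T' j))"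
    by (simp add: card_cartesian_product algebra_simps)
  moreover have "(\<Sum>(i, j)\<in>I \<times> J. of_bool (x \<in> S i \<inter> T j)) \<le> \<alpha> * \<beta> * card (I \<times> J)"
    "(\<Sum>(i, j)\<in>I \<times> J. of_bool (x \<in> S' i \<inter> T' j)) \<le> \<alpha> * \<beta> * card (I \<times> J)"
    if "x \<in> {1..n}" for x
    using S T that unfolding paired_family_def by (blast intro: marg)+
  moreover have "I \<times> J \<noteq> {}" using S T by (auto simp: paired_family_def)
  moreover have "\<forall>(i, j)\<in>I \<times> J. S i \<inter> T j \<subseteq> {1..n} \<and> S' i \<inter> T' j \<subseteq> {1..n}"
    using Ssub Tsub by blast
  ultimately show ?thesis
    using fin unfolding paired_family_def case_prod_unfold by blast
qed

context
  fixes n m :: nat and \<epsilon> M :: real and g :: "nat set \<Rightarrow> real" and P N :: "nat \<Rightarrow> nat set"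
  assumes am: "approx_modular n \<epsilon> g" and "m > 0"
    and P: "\<forall>i<m. P i \<subseteq> {1..n} \<and> g (P i) = M"
    and N: "\<forall>i<m. N i \<subseteq> {1..n} \<and> g (N i) = - M"
    and marginals_eq: "\<forall>x\<in>{1..n}. (\<Sum>i<m. of_bool (x \<in> P i)) = (\<Sum>i<m. of_bool (x \<in> N i) :: real)"
begin

text \<open>An item in \<open>c\<close> of the \<open>P i\<close> lies in \<open>c\<close> of the
  \<open>N i\<close>, hence in \<open>m - c\<close> of their complements: \<open>m\<close> out of
  \<open>2 * m\<close> sets. Complementing costs \<open>\<epsilon>\<close> twice per
  \<open>i\<close>, and \<open>g {1..n} + g {}\<close> cancels in the difference.\<close>

lemma paired_family_half:
  "paired_family n \<epsilon> g M (UNIV \<times> {..<m})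
     (\<lambda>(b, i). if b then P i else {1..n} - N i) (\<lambda>(b, i). if b then N i else {1..n} - P i) (1/2) (1/2)"
proof -
  have sum: "(\<Sum>(b, i)\<in>UNIV \<times> {..<m}. h b i) = (\<Sum>i<m. h True i + h False i)"
    for h :: "bool \<Rightarrow> nat \<Rightarrow> real"
    by (simp add: sum.cartesian_product[symmetric] UNIV_bool sum.distrib)
  have compl: "\<bar>g A + g ({1..n} - A) - g {1..n} - g {}\<bar> \<le> \<epsilon>" if "A \<subseteq> {1..n}" for A
  proof -
    have "A \<union> ({1..n} - A) = {1..n}" "A \<inter> ({1..n} - A) = {}" using that by auto
    then show ?thesis using am that unfolding approx_modular_def by (metis Diff_subset)
  qed
  have card: "real (card ((UNIV :: bool set) \<times> {..<m})) = 2 * m"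
    by (simp add: card_cartesian_product)
  have "(\<Sum>(b, i)\<in>UNIV \<times> {..<m}. of_bool (x \<in> (if b then P i else {1..n} - N i))) = real m"
    "(\<Sum>(b, i)\<in>UNIV \<times> {..<m}. of_bool (x \<in> (if b then N i else {1..n} - P i))) = real m"
    if "x \<in> {1..n}" for x
    using that bspec[OF marginals_eq that] unfolding sum
    by (simp_all add: sum.distrib of_bool_not_iff sum_subtractf)
  moreover have "(\<Sum>i<m. 4 * M - 2 * \<epsilon>)
      \<le> (\<Sum>i<m. (g (P i) - g (N i)) + (g ({1..n} - N i) - g ({1..n} - P i)))"
  proof (rule sum_mono)
    fix i assume "i \<in> {..<m}"
    then have i: "i < m" by simp
    show "4 * M - 2 * \<epsilon> \<le> (g (P i) - g (N i)) + (g ({1..n} - N i) - g ({1..n} - P i))"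
      using P N i compl[of "P i"] compl[of "N i"] by auto
  qed
  then have "2 * (2 * m) * (M - 1/2 * \<epsilon>) \<le> (\<Sum>(b, i)\<in>UNIV \<times> {..<m}.
      g (if b then P i else {1..n} - N i) - g (if b then N i else {1..n} - P i))"
    unfolding sum by (simp add: algebra_simps)
  ultimately show ?thesis
    unfolding paired_family_def card using P N \<open>m > 0\<close> by (auto simp: case_prod_unfold)
qed

text \<open>Bounding \<open>g (P - N)\<close> and \<open>g (N - P)\<close> separately costs \<open>g (P \<union> N)\<close> each time; in their
  difference this unknown term cancels.\<close>

lemma paired_family_quarter:
  "paired_family n \<epsilon> g M ({..<m} \<times> {..<m}) (\<lambda>(i, j). P i - N j) (\<lambda>(i, j). N j - P i) (1/4) 1"
proof -
  have marg: "(\<Sum>(i, j)\<in>{..<m} \<times> {..<m}. of_bool (x \<in> P i - N j)) \<le> 1/4 * real (card ({..<m} \<times> {..<m}))"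
    "(\<Sum>(i, j)\<in>{..<m} \<times> {..<m}. of_bool (x \<in> N j - P i)) \<le> 1/4 * real (card ({..<m} \<times> {..<m}))"
    if x: "x \<in> {1..n}" for x
  proof -
    define c where "c = (\<Sum>i<m. of_bool (x \<in> P i) :: real)"
    have c: "(\<Sum>i<m. of_bool (x \<in> N i)) = c" using bspec[OF marginals_eq x] by (simp add: c_def)
    \<comment> \<open>Independent \<open>i\<close> and \<open>j\<close> give frequency
      \<open>c * (m - c)\<close>, which is largest at \<open>c = m / 2\<close>.\<close>
    have le: "c * (m - c) \<le> 1/4 * real (card ({..<m} \<times> {..<m}))"
      using zero_le_power2[of "m - 2 * c"]
      by (simp add: card_cartesian_product power2_eq_square algebra_simps)
    have "(\<Sum>(i, j)\<in>{..<m} \<times> {..<m}. of_bool (x \<in> P i - N j))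
        = (\<Sum>i<m. of_bool (x \<in> P i)) * (\<Sum>j<m. 1 - of_bool (x \<in> N j) :: real)"
      unfolding sum_product sum.cartesian_product by (intro sum.cong) auto
    also have "\<dots> = c * (m - c)" by (simp add: sum_subtractf c c_def)
    finally show "(\<Sum>(i, j)\<in>{..<m} \<times> {..<m}. of_bool (x \<in> P i - N j))
        \<le> 1/4 * real (card ({..<m} \<times> {..<m}))" using le by simp
    have "(\<Sum>(i, j)\<in>{..<m} \<times> {..<m}. of_bool (x \<in> N j - P i))
        = (\<Sum>i<m. 1 - of_bool (x \<in> P i)) * (\<Sum>j<m. of_bool (x \<in> N j) :: real)"
      unfolding sum_product sum.cartesian_product by (intro sum.cong) auto
    also have "\<dots> = c * (m - c)" by (simp add: sum_subtractf c c_def[symmetric])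
    finally show "(\<Sum>(i, j)\<in>{..<m} \<times> {..<m}. of_bool (x \<in> N j - P i))
        \<le> 1/4 * real (card ({..<m} \<times> {..<m}))" using le by simp
  qed
  have "(\<Sum>(i, j)\<in>{..<m} \<times> {..<m}. 2 * (M - 1 * \<epsilon>))
      \<le> (\<Sum>(i, j)\<in>{..<m} \<times> {..<m}. g (P i - N j) - g (N j - P i))"
  proof (intro sum_mono, unfold split_paired_all prod.case mem_Times_iff fst_conv snd_conv, elim conjE)
    fix i j assume "i \<in> {..<m}" "j \<in> {..<m}"
    then have ij: "P i \<subseteq> {1..n}" "g (P i) = M" "N j \<subseteq> {1..n}" "g (N j) = - M"
      using P N by auto
    have mod: "\<bar>g (A - B) + g B - g (A \<union> B) - g {}\<bar> \<le> \<epsilon>" if "A \<subseteq> {1..n}" "B \<subseteq> {1..n}" for A B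
    proof -
      have "(A - B) \<union> B = A \<union> B" "(A - B) \<inter> B = {}" "A - B \<subseteq> {1..n}" using that by auto
      then show ?thesis using am that unfolding approx_modular_def by metis
    qed
    show "2 * (M - 1 * \<epsilon>) \<le> g (P i - N j) - g (N j - P i)"
      using mod[OF ij(1,3)] mod[OF ij(3,1)] ij unfolding Un_commute[of "N j" "P i"] by argo
  qed
  then have "2 * card ({..<m} \<times> {..<m}) * (M - 1 * \<epsilon>)
      \<le> (\<Sum>(i, j)\<in>{..<m} \<times> {..<m}. g (P i - N j) - g (N j - P i))"
    by (simp add: case_prod_unfold algebra_simps)
  moreover have "P i - N j \<subseteq> {1..n}" "N j - P i \<subseteq> {1..n}" if "i < m" "j < m" for i j
    using P N that by blast+
  ultimately show ?thesis
    unfolding paired_family_def using \<open>m > 0\<close> marg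
    by (simp add: case_prod_unfold mem_Times_iff lessThan_empty_iff)
qed

end

section \<open>From paired families to the Kalton constant\<close>

lemma paired_family_expander_bound:
  fixes I :: "'i set"
  assumes ex: "expanders_exist \<alpha> r \<theta>" and "\<alpha> > 0" and "\<epsilon> \<ge> 0"
    and am: "approx_modular n \<epsilon> g" and bound: "\<forall>S\<subseteq>{1..n}. \<bar>g S\<bar> \<le> M"
    and fam: "paired_family n \<epsilon> g M I S S' \<alpha> \<delta>"
    and "2 * r + \<delta> \<ge> 2"
  shows "M * (1 - \<theta>) \<le> (2 * r + \<delta> - 1 - \<theta>) * \<epsilon>"
proof -
  note bound = bound[rule_format]
  obtain k' where k': "k' > 0" "\<And>k. k > 0 \<Longrightarrow> k' dvd k \<Longrightarrow>
      \<exists>(V :: nat set) (W :: nat set) E. is_expander \<alpha> r \<theta> k V W E"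
    using ex unfolding expanders_exist_def by blast
  have I: "finite I" "card I > 0"
    using fam by (auto simp: paired_family_def card_gt_0_iff)
  obtain q :: nat where q: "real q > 1 / \<alpha>" using reals_Archimedean2 by blast
  moreover have "1 / \<alpha> > 0" using \<open>\<alpha> > 0\<close> by simp
  ultimately have "q > 0" by (metis less_trans of_nat_0_less_iff)
  \<comment> \<open>The factor \<open>k'\<close> provides the graph, \<open>q\<close> makes
    singletons expand, and \<open>card I\<close> lets the \<open>2 * k\<close> left vertices carry
    each index equally often, namely \<open>Q\<close> times.\<close>
  define k where "k = k' * q * card I"
  have "k > 0" "k' dvd k" using k'(1) \<open>q > 0\<close> I by (simp_all add: k_def)
  then obtain V W :: "nat set" and E where E: "is_expander \<alpha> r \<theta> k V W E" using k'(2) by blast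
  have "q \<le> k" using k'(1) I by (simp add: k_def)
  then have "1 / \<alpha> \<le> 2 * real k" using q by linarith
  then have ge1: "1 \<le> 2 * real k * \<alpha>" using \<open>\<alpha> > 0\<close> by (simp add: field_simps)
  have finV: "finite V" and cardV: "real (card V) = 2 * real k" and cardE: "card E = 2 * real k * r"
    and W: "finite W" "E \<subseteq> V \<times> W" "real (card W) = 2 * \<theta> * real k" and "\<theta> < 1" "\<theta> \<ge> 0"
    using E by (auto simp: is_expander_def)
  define Q where "Q = 2 * k' * q"
  have kQ: "2 * real k = real Q * card I" by (simp add: k_def Q_def)
  then have "real (card V) = real (card (I \<times> {..<Q}))"
    using cardV by (simp add: card_cartesian_product)
  then have "card V = card (I \<times> {..<Q})" by (simp only: of_nat_eq_iff)
  then obtain \<phi> where \<phi>: "bij_betw \<phi> V (I \<times> {..<Q})"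
    using finite_same_card_bij[OF finV, of "I \<times> {..<Q}"] I(1) by auto
  have sum: "(\<Sum>v\<in>V. h (fst (\<phi> v))) = Q * (\<Sum>i\<in>I. h i)" for h :: "'i \<Rightarrow> real"
  proof -
    have "(\<Sum>v\<in>V. h (fst (\<phi> v))) = (\<Sum>p\<in>I \<times> {..<Q}. h (fst p))"
      using sum.reindex_bij_betw[OF \<phi>, of "\<lambda>p. h (fst p)"] .
    also have "\<dots> = Q * (\<Sum>i\<in>I. h i)"
      by (simp add: sum.cartesian_product' sum_distrib_left)
    finally show ?thesis .
  qed
  have \<phi>I: "fst (\<phi> v) \<in> I" if "v \<in> V" for v
    using bij_betw_apply[OF \<phi> that] by auto
  have marg: "real (card {v\<in>V. x \<in> A (fst (\<phi> v))}) \<le> 2 * real k * \<alpha>"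
    if "(\<Sum>i\<in>I. of_bool (x \<in> A i)) \<le> \<alpha> * card I" for A and x :: nat
  proof -
    have "real (card {v\<in>V. x \<in> A (fst (\<phi> v))}) = (\<Sum>v\<in>V. of_bool (x \<in> A (fst (\<phi> v))))"
      using finV by (simp add: Collect_conj_eq)
    also have "\<dots> = Q * (\<Sum>i\<in>I. of_bool (x \<in> A i) :: real)" by (rule sum)
    also have "\<dots> \<le> Q * (\<alpha> * card I)" using that by (rule mult_left_mono) simp
    finally show ?thesis unfolding kQ by (simp add: algebra_simps)
  qed
  define w where "w = real (card (E `` V))"
  have "E `` V \<subseteq> W" using W(2) by blast
  then have "w \<le> real (card W)" unfolding w_def using card_mono[OF W(1)] by simp
  then have w: "w \<le> 2 * \<theta> * real k" unfolding W(3) .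
  have sub: "S (fst (\<phi> v)) \<subseteq> {1..n}" "S' (fst (\<phi> v)) \<subseteq> {1..n}" if "v \<in> V" for v
    using fam \<phi>I[OF that] unfolding paired_family_def by blast+
  have marg': "real (card {v\<in>V. x \<in> S (fst (\<phi> v))}) \<le> 2 * real k * \<alpha>"
    "real (card {v\<in>V. x \<in> S' (fst (\<phi> v))}) \<le> 2 * real k * \<alpha>" if "x \<in> {1..n}" for x
    using fam that unfolding paired_family_def by (blast intro: marg)+
  have pos: "Q * (\<Sum>i\<in>I. g (S i) - g {})
      \<le> w * (M - g {}) + (2 * (2 * real k * r) - 2 * real k - w) * \<epsilon>"
    using expander_sum_bound[OF E ge1 am abs_le_D1[OF bound] sub(1) marg'(1)]
    unfolding sum[of "\<lambda>i. g (S i) - g {}"] w_def[symmetric] cardE cardV by simp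
  from expander_sum_bound[OF E ge1 approx_modular_uminus[OF am] abs_le_D2[OF bound] sub(2) marg'(2)]
  have neg: "Q * (\<Sum>i\<in>I. - g (S' i) - - g {})
      \<le> w * (M - - g {}) + (2 * (2 * real k * r) - 2 * real k - w) * \<epsilon>"
    unfolding sum[of "\<lambda>i. - g (S' i) - - g {}"] w_def[symmetric] cardE cardV by simp
  have "2 * (2 * real k) * (M - \<delta> * \<epsilon>) = Q * (2 * card I * (M - \<delta> * \<epsilon>))" by (simp add: kQ)
  also have "\<dots> \<le> Q * (\<Sum>i\<in>I. g (S i) - g (S' i))"
    using fam by (intro mult_left_mono) (simp_all add: paired_family_def)
  also have "\<dots> = Q * (\<Sum>i\<in>I. g (S i) - g {}) + Q * (\<Sum>i\<in>I. - g (S' i) - - g {})"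
    by (simp add: sum_subtractf sum_negf algebra_simps)
  also have "\<dots> \<le> 2 * (w * M + (2 * (2 * real k * r) - 2 * real k - w) * \<epsilon>)"
    using pos neg by (simp add: algebra_simps)
  \<comment> \<open>Subtracting \<open>\<epsilon> * (2 * real k - w)\<close> on both sides collects
    \<open>w\<close> in a single factor.\<close>
  finally have main: "(M - \<epsilon>) * (2 * real k - w) \<le> 2 * real k * ((2 * r + \<delta> - 2) * \<epsilon>)"
    by (simp add: algebra_simps)
  \<comment> \<open>The upper bound on \<open>w\<close> may be inserted when
    \<open>M - \<epsilon>\<close> is positive. Otherwise the left side is nonpositive, and
    \<open>2 * r + \<delta> \<ge> 2\<close> keeps the right side nonnegative.\<close>
  have "(M - \<epsilon>) * (1 - \<theta>) \<le> (2 * r + \<delta> - 2) * \<epsilon>"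
  proof (cases "M \<le> \<epsilon>")
    case True
    then have "(M - \<epsilon>) * (1 - \<theta>) \<le> 0" using \<open>\<theta> < 1\<close> by (simp add: mult_nonpos_nonneg)
    also have "0 \<le> (2 * r + \<delta> - 2) * \<epsilon>" using assms by simp
    finally show ?thesis .
  next
    case False
    have "2 * real k * ((M - \<epsilon>) * (1 - \<theta>)) = (M - \<epsilon>) * (2 * real k - 2 * \<theta> * real k)"
      by (simp add: algebra_simps)
    also have "\<dots> \<le> (M - \<epsilon>) * (2 * real k - w)" using w False by (intro mult_left_mono) auto
    also note main
    finally show ?thesis using \<open>k > 0\<close> by simp
  qed
  then show ?thesis by (simp add: algebra_simps)
qed

text \<open>A family with shortfall \<open>\<delta>\<close> gives the bound as soon as
  \<open>\<delta> \<le> N\<^sub>2 + 1\<close>. The families used have \<open>\<delta>\<close> equal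
  to 1/2, 1, 3 and 9/2; the one of frequency 1/16 also serves \<alpha> = 1/8. Equality holds for
  \<alpha> = 1/2 and \<alpha> = 1/8.\<close>

lemma extremal_norm_bound:
  assumes \<alpha>: "\<alpha> \<in> {1/2, 1/4, 1/8, 1/16, 1/32}" and ex: "expanders_exist \<alpha> r \<theta>" and "2 < r"
    and N2: "\<alpha> = 1/2 \<Longrightarrow> N\<^sub>2 = - 1/2" "\<alpha> = 1/4 \<Longrightarrow> N\<^sub>2 = 1/2" "\<alpha> = 1/8 \<Longrightarrow> N\<^sub>2 = 2"
      "\<alpha> = 1/16 \<Longrightarrow> N\<^sub>2 = 3" "\<alpha> = 1/32 \<Longrightarrow> N\<^sub>2 = 9/2"
    and "\<epsilon> \<ge> 0" and am: "approx_modular n \<epsilon> g"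
    and "M > 0" and bound: "\<forall>S\<subseteq>{1..n}. \<bar>g S\<bar> \<le> M"
    and best: "\<forall>\<Delta>. approx_linear n \<Delta> g \<longrightarrow> M \<le> \<Delta>"
  shows "M * (1 - \<theta>) \<le> (2 * r + N\<^sub>2 - \<theta>) * \<epsilon>"
proof -
  have "\<alpha> > 0" using \<alpha> by auto
  obtain m :: nat and P N where ext: "m > 0" "\<forall>i<m. P i \<subseteq> {1..n} \<and> g (P i) = M"
    "\<forall>i<m. N i \<subseteq> {1..n} \<and> g (N i) = - M"
    "\<forall>x\<in>{1..n}. (\<Sum>i<m. of_bool (x \<in> P i)) = (\<Sum>i<m. of_bool (x \<in> N i) :: real)"
    by (rule extremal_families[OF \<open>M > 0\<close> bound best])
  note half = paired_family_half[OF am ext] and quarter = paired_family_quarter[OF am ext]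
  note sixteenth = paired_family_Int[OF am bound quarter quarter]
  note thirtysecond = paired_family_Int[OF am bound sixteenth half]
  note expand = paired_family_expander_bound[OF ex \<open>\<alpha> > 0\<close> \<open>\<epsilon> \<ge> 0\<close> am bound paired_family_mono]
  have mono: "M * (1 - \<theta>) \<le> (2 * r + N\<^sub>2 - \<theta>) * \<epsilon>"
    if "M * (1 - \<theta>) \<le> (2 * r + \<delta> - 1 - \<theta>) * \<epsilon>" "\<delta> \<le> N\<^sub>2 + 1" for \<delta>
  proof -
    have "(2 * r + \<delta> - 1 - \<theta>) * \<epsilon> \<le> (2 * r + N\<^sub>2 - \<theta>) * \<epsilon>"
      using that(2) \<open>\<epsilon> \<ge> 0\<close> by (intro mult_right_mono) auto
    with that(1) show ?thesis by linarith
  qed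
  consider "\<alpha> = 1/2" | "\<alpha> = 1/4" | "\<alpha> = 1/8 \<or> \<alpha> = 1/16" | "\<alpha> = 1/32"
    using \<alpha> by blast
  then show ?thesis
  proof cases
    case 1
    show ?thesis
      by (rule mono, rule expand[OF half]) (use 1 N2(1) \<open>2 < r\<close> in simp_all)
  next
    case 2
    show ?thesis
      by (rule mono, rule expand[OF quarter]) (use 2 N2(2) \<open>2 < r\<close> in simp_all)
  next
    case 3
    show ?thesis
      by (rule mono, rule expand[OF sixteenth]) (use 3 N2(3,4) \<open>2 < r\<close> in auto)
  next
    case 4
    show ?thesis
      by (rule mono, rule expand[OF thirtysecond]) (use 4 N2(5) \<open>2 < r\<close> in simp_all)
  qed
qed

text \<open>Passes to the residual \<open>g = f - l\<close> of a best approximation. Adding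
  \<open>l\<close> to an approximation of \<open>g\<close> gives one of \<open>f\<close> with the
  same error, so \<open>M\<close> stays minimal for \<open>g\<close>.\<close>

lemma kalton_bound_of_best_approximations:
  assumes "K \<ge> 0"
    and K: "\<And>n \<epsilon> g M. \<epsilon> \<ge> 0 \<Longrightarrow> approx_modular n \<epsilon> g \<Longrightarrow> M > 0 \<Longrightarrow> \<forall>S\<subseteq>{1..n}. \<bar>g S\<bar> \<le> M \<Longrightarrow>
      \<forall>\<Delta>. approx_linear n \<Delta> g \<longrightarrow> M \<le> \<Delta> \<Longrightarrow> M \<le> K * \<epsilon>"
  shows "kalton_bound K"
proof -
  have "approx_linear n (K * \<epsilon>) f" if "\<epsilon> \<ge> 0" and f: "approx_modular n \<epsilon> f" for n \<epsilon> f
  proof -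
    obtain l M where l: "linear_set_function n l" "\<And>S. S \<subseteq> {1..n} \<Longrightarrow> \<bar>f S - l S\<bar> \<le> M"
      and best: "\<And>\<Delta>. approx_linear n \<Delta> f \<Longrightarrow> M \<le> \<Delta>"
      using exists_best_linear by metis
    define g where "g S = f S - l S" for S
    have am: "approx_modular n \<epsilon> g"
      unfolding g_def by (rule approx_modular_diff_linear[OF f l(1)])
    have bound: "\<forall>S\<subseteq>{1..n}. \<bar>g S\<bar> \<le> M" using l(2) by (simp add: g_def)
    have "approx_linear n \<Delta> f" if \<Delta>: "approx_linear n \<Delta> g" for \<Delta>
    proof -
      obtain l' where l': "linear_set_function n l'" "\<forall>S\<subseteq>{1..n}. \<bar>g S - l' S\<bar> \<le> \<Delta>"
        using \<Delta> unfolding approx_linear_def by blast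
      show ?thesis unfolding approx_linear_def
        using linear_set_function_add[OF l(1) l'(1)] l'(2)
        by (intro exI[of _ "\<lambda>S. l S + l' S"]) (simp add: g_def algebra_simps)
    qed
    then have best_g: "\<forall>\<Delta>. approx_linear n \<Delta> g \<longrightarrow> M \<le> \<Delta>" using best by blast
    have "M \<le> K * \<epsilon>"
    proof (cases "M > 0")
      case True
      from K[OF \<open>\<epsilon> \<ge> 0\<close> am True bound best_g] show ?thesis .
    next
      case False
      then show ?thesis using \<open>K \<ge> 0\<close> \<open>\<epsilon> \<ge> 0\<close> by (meson linorder_not_less mult_nonneg_nonneg order_trans)
    qed
    then show ?thesis unfolding approx_linear_def using l by (meson order_trans)
  qed
  then show ?thesis unfolding kalton_bound_def by blast
qed

theorem theorem8:
  fixes \<alpha> r \<theta> N\<^sub>2 :: real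
  assumes "\<alpha> \<in> {1/2, 1/4, 1/8, 1/16, 1/32}"
    and "r \<ge> 0" and "\<theta> \<ge> 0"
    and "expanders_exist \<alpha> r \<theta>"
    and "\<alpha> = 1/2 \<Longrightarrow> N\<^sub>2 = - 1/2"
    and "\<alpha> = 1/4 \<Longrightarrow> N\<^sub>2 = 1/2"
    and "\<alpha> = 1/8 \<Longrightarrow> N\<^sub>2 = 2"
    and "\<alpha> = 1/16 \<Longrightarrow> N\<^sub>2 = 3"
    and "\<alpha> = 1/32 \<Longrightarrow> N\<^sub>2 = 9/2"
  shows "strong_kalton_constant \<le> ereal ((2 * r + N\<^sub>2 - \<theta>) / (1 - \<theta>))"
  unfolding strong_kalton_constant_le_iff
proof (rule kalton_bound_of_best_approximations)
  \<comment> \<open>A single expander, taken at \<open>k = k'\<close>, already carries the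
    constraints on \<open>r\<close> and \<open>\<theta>\<close>.\<close>
  obtain k and V W :: "nat set" and E where "is_expander \<alpha> r \<theta> k V W E"
    using assms(4) unfolding expanders_exist_def by (meson dvd_refl)
  then have "2 < r" "\<theta> < 1" by (simp_all add: is_expander_def)
  have "N\<^sub>2 \<ge> - 1/2" using assms(1,5-9) by (elim insertE) simp_all
  with \<open>2 < r\<close> \<open>\<theta> < 1\<close> show "0 \<le> (2 * r + N\<^sub>2 - \<theta>) / (1 - \<theta>)" by simp
  fix n \<epsilon> g M
  assume "\<epsilon> \<ge> 0" "approx_modular n \<epsilon> g" "M > 0" "\<forall>S\<subseteq>{1..n}. \<bar>g S\<bar> \<le> M"
    "\<forall>\<Delta>. approx_linear n \<Delta> g \<longrightarrow> M \<le> \<Delta>"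
  from extremal_norm_bound[OF assms(1,4) \<open>2 < r\<close> assms(5-9) this]
  show "M \<le> (2 * r + N\<^sub>2 - \<theta>) / (1 - \<theta>) * \<epsilon>" using \<open>\<theta> < 1\<close> by (simp add: field_simps)
qed

end
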